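(* Let $g\geq2$ be an integer and let $\mathcal{D}=\{d_1,\dots,d_t\}\subseteq\{0,\dots,g-1\}$ be a set of $t\ge2$ distinct digits, where $d_1$ is the smallest digit. Let $a,a'\in\mathbb{N}$ satisfy $\gcd(g,a)=1$, and put $p=a'\phi(a(g-1))$, where $\phi$ is Euler's totient function. Then $\mathcal{C}_{g,\mathcal{D}}$ is jointly uniformly distributed mod $(a,a')$ if and only if $\gcd(a,d_2-d_1,\dots,d_t-d_1)=1$ and there exists a finite word $w$ with letters in $\mathcal{D}$ such that $(w)_g\equiv0\pmod a$, $S_g(w)\equiv1\pmod{a'}$ and $|w|\equiv0\pmod p$.
   Context: $\mathbb{N}=\{1,2,\dots\}$ and $\mathbb{N}_0=\mathbb{N}\cup\{0\}$. $\mathcal{C}_{g,\mathcal{D}}=\{\sum_{i=0}^m w_ig^i: m\in\mathbb{N}_0,\ w_i\in\mathcal{D}\}$. $S_g(n)$ is the sum of the base-$g$ digits of $n$. For a word $w=w_0\cdots w_{n-1}$ of digits: $|w|=n$, $(w)_g=w_0+w_1g+\dots+w_{n-1}g^{n-1}$, and $S_g(w)=w_0+\dots+w_{n-1}$. A set $A\subseteq\mathbb{N}_0$ is jointly uniformly distributed mod $(a,a')$ if $\lim_{N\to\infty}\frac{|\{n\in A: n\equiv b\pmod a,\ S_g(n)\equiv b'\pmod{a'}\}\cap[0,N)|}{|A\cap[0,N)|}=\frac1{aa'}$ for every $b\in\mathbb{Z}/a\mathbb{Z}$, $b'\in\mathbb{Z}/a'\mathbb{Z}$. *)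

theory Defs
  imports Complex_Main "HOL-Number_Theory.Number_Theory"
begin

text \<open>Only positions \<open>i\<close> with \<open>g ^ i \<le> n\<close> can carry a nonzero digit of \<open>n\<close>; for \<open>g \<ge> 2\<close> there are
  finitely many of them.\<close>

definition digit_sum :: "nat \<Rightarrow> nat \<Rightarrow> nat" where
  "digit_sum g n = (\<Sum>i | g ^ i \<le> n. n div g ^ i mod g)"

definition cantor_set :: "nat \<Rightarrow> nat set \<Rightarrow> nat set" where
  "cantor_set g D = {\<Sum>i=0..m. w i * g ^ i | (m :: nat) (w :: nat \<Rightarrow> nat). \<forall>i\<le>m. w i \<in> D}"

text \<open>Words are lists of digits, least significant digit first.\<close>

definition word_value :: "nat \<Rightarrow> nat list \<Rightarrow> nat" where
  "word_value g w = (\<Sum>i<length w. w ! i * g ^ i)"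

definition word_digit_sum :: "nat list \<Rightarrow> nat" where
  "word_digit_sum w = sum_list w"

text \<open>The classes of \<open>\<int>/a\<int>\<close> and \<open>\<int>/a'\<int>\<close> are represented by \<open>b < a\<close> and \<open>b' < a'\<close>; both moduli are
  meant to be positive.\<close>

definition jointly_unif_distributed :: "nat \<Rightarrow> nat set \<Rightarrow> nat \<Rightarrow> nat \<Rightarrow> bool" where
  "jointly_unif_distributed g A a a' \<longleftrightarrow>
     (\<forall>b<a. \<forall>b'<a'.
        (\<lambda>N. real (card ({n \<in> A. [n = b] (mod a) \<and> [digit_sum g n = b'] (mod a')} \<inter> {0..<N})) /
              real (card (A \<inter> {0..<N})))
          \<longlonglongrightarrow> 1 / (real a * real a'))"

end

theory Submission
  imports Defs
begin

text \<open>Words whose length is a multiple of \<open>p\<close> perform a random walk on \<open>\<int>/a\<int> \<times> \<int>/a'\<int>\<close>: as \<open>g\<^sup>p \<equiv> 1\<close>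
  modulo \<open>a (g - 1)\<close>, concatenation adds the pairs (value, digit sum), and constant words have class
  \<open>(0, 0)\<close>. Changing one digit of a constant word produces classes \<open>(\<delta>, \<delta>)\<close> with \<open>\<delta>\<close> a difference of
  digits; together with the class \<open>(0, 1)\<close> of the given word they generate the whole group, so for some
  \<open>k\<close> every class contains a word of length \<open>k\<close>. Then the oscillation over the classes of the class
  frequencies contracts geometrically along the lengths \<open>q k\<close>. Initial segments of the Cantor set are,
  up to a bounded error, disjoint unions of translates of the values of all words of a fixed length
  \<open>K\<close>, which transfers equidistribution from words to the set.

  Conversely, \<open>[0, g\<^bsup>k+1\<^esup>)\<close> contains at least \<open>3/2\<close> times as many points of the Cantor set as
  \<open>[0, g\<^bsup>k\<^esup>)\<close>, so a class of positive density contains words of every large length. All words of one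
  length have the same value modulo a common divisor of the digit differences, so that if this divisor
  also divides \<open>a\<close>, it is \<open>1\<close>.\<close>

section \<open>Values and digit sums of words\<close>

lemma word_value_Nil [simp]: "word_value g [] = 0"
  by (simp add: word_value_def)

lemma word_value_Cons [simp]: "word_value g (x # w) = x + g * word_value g w"
  by (simp add: word_value_def sum.lessThan_Suc_shift sum_distrib_left mult_ac del: sum.lessThan_Suc)

lemma word_value_append [simp]:
  "word_value g (u @ w) = word_value g u + g ^ length u * word_value g w"
  by (induction u) (simp_all add: algebra_simps)

lemma word_value_less:
  assumes "set w \<subseteq> {..<g}"
  shows "word_value g w < g ^ length w"
  using assms
proof (induction w)
  case (Cons x w)
  then have "x < g" "Suc (word_value g w) \<le> g ^ length w" by auto
  then have "x + g * word_value g w < g * Suc (word_value g w)" by simp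
  also have "\<dots> \<le> g * g ^ length w"
    using \<open>Suc (word_value g w) \<le> g ^ length w\<close> by (intro mult_le_mono) auto
  finally show ?case by simp
qed simp

lemma word_value_inj:
  assumes "set w \<subseteq> {..<g}" "set w' \<subseteq> {..<g}" "length w = length w'"
    and "word_value g w = word_value g w'"
  shows "w = w'"
  using assms(3,1,2,4)
proof (induction w w' rule: list_induct2)
  case (Cons x w y w')
  then have x: "x < g" "y < g" and eq: "x + g * word_value g w = y + g * word_value g w'" by auto
  have "x = y" using arg_cong[OF eq, of "\<lambda>n. n mod g"] x by simp
  moreover have "word_value g w = word_value g w'"
    using eq \<open>x = y\<close> x by simp
  ultimately show ?case using Cons by simp
qed simp

text \<open>Positions \<open>i < k\<close> with \<open>g ^ i > n\<close> carry the digit 0, so the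
  index set depending on \<open>n\<close> can be traded for a fixed range, along which one can
  induct over a word.\<close>

lemma digit_sum_eq:
  assumes "g \<ge> 2" "n < g ^ k"
  shows "digit_sum g n = (\<Sum>i<k. n div g ^ i mod g)"
  unfolding digit_sum_def
proof (rule sum.mono_neutral_left)
  show "{i. g ^ i \<le> n} \<subseteq> {..<k}"
  proof
    fix i assume "i \<in> {i. g ^ i \<le> n}"
    then have "g ^ i < g ^ k" using assms(2) by simp
    moreover have "1 < g" using assms(1) by simp
    ultimately show "i \<in> {..<k}" using power_less_imp_less_exp[of g i k] by blast
  qed
qed auto

lemma digit_sum_word_value:
  assumes "g \<ge> 2" "set w \<subseteq> {..<g}"
  shows "digit_sum g (word_value g w) = sum_list w"
proof -
  have "(\<Sum>i<length w. word_value g w div g ^ i mod g) = sum_list w"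
    using assms(2)
  proof (induction w)
    case (Cons x w)
    then have x: "x < g" by simp
    have "(x + g * word_value g w) div g ^ Suc i = word_value g w div g ^ i" for i
      using x assms(1) by (simp add: div_mult2_eq)
    then show ?case using Cons x
      by (simp add: sum.lessThan_Suc_shift del: sum.lessThan_Suc power_Suc)
  qed simp
  then show ?thesis
    using digit_sum_eq[OF assms(1) word_value_less[OF assms(2)]] by simp
qed

text \<open>The sums in \<open>cantor_set\<close> have at least one term, hence the restriction to
  nonempty words: 0 belongs to the set only if it is a digit of \<open>D\<close>.\<close>

lemma cantor_set_eq: "cantor_set g D = word_value g ` {w. w \<noteq> [] \<and> set w \<subseteq> D}"
proof (intro equalityI subsetI)
  fix n assume "n \<in> cantor_set g D"
  then obtain m w where n: "n = (\<Sum>i=0..m. w i * g ^ i)" and w: "\<forall>i\<le>m. w i \<in> D"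
    by (auto simp: cantor_set_def)
  let ?w = "map w [0..<Suc m]"
  have "word_value g ?w = (\<Sum>i<Suc m. w i * g ^ i)"
    unfolding word_value_def by (rule sum.cong) (auto simp del: upt_Suc)
  also have "\<dots> = n" by (simp add: n lessThan_Suc_atMost atMost_atLeast0 del: sum.lessThan_Suc)
  finally have "word_value g ?w = n" .
  moreover have "?w \<noteq> []" "set ?w \<subseteq> D" using w by auto
  ultimately show "n \<in> word_value g ` {w. w \<noteq> [] \<and> set w \<subseteq> D}" by blast
next
  fix n assume "n \<in> word_value g ` {w. w \<noteq> [] \<and> set w \<subseteq> D}"
  then obtain w where w: "n = word_value g w" "w \<noteq> []" "set w \<subseteq> D" by auto
  have "{..<length w} = {0..length w - 1}" using w(2) by (cases w) auto
  then have "n = (\<Sum>i=0..length w - 1. w ! i * g ^ i)" by (simp add: w word_value_def)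
  moreover have "\<forall>i\<le>length w - 1. w ! i \<in> D"
  proof (intro allI impI)
    fix i assume "i \<le> length w - 1"
    then have "i < length w" using w(2) by (cases w) auto
    then show "w ! i \<in> D" using w(3) nth_mem by blast
  qed
  ultimately show "n \<in> cantor_set g D" unfolding cantor_set_def by blast
qed

section \<open>Counting points of the Cantor set\<close>

definition words :: "nat set \<Rightarrow> nat \<Rightarrow> nat list set" where
  "words D k = {w. set w \<subseteq> D \<and> length w = k}"

locale digit_set =
  fixes g :: nat and D :: "nat set"
  assumes base: "2 \<le> g" and digits: "D \<subseteq> {..<g}" and two_digits: "2 \<le> card D"
begin

abbreviation t where "t \<equiv> card D"
abbreviation C where "C \<equiv> cantor_set g D"

lemma finite_D: "finite D"
  using digits finite_subset by blast

lemma finite_words: "finite (words D k)"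
  unfolding words_def using finite_lists_length_eq[OF finite_D] by simp

lemma card_words: "card (words D k) = t ^ k"
  unfolding words_def using card_lists_length_eq[OF finite_D] by simp

lemma inj_on_word_value: "inj_on (word_value g) (words D k)"
  using digits by (auto simp: words_def inj_on_def intro!: word_value_inj)

lemma word_value_less_power: "w \<in> words D k \<Longrightarrow> word_value g w < g ^ k"
  using word_value_less[of w g] digits by (auto simp: words_def)

lemma word_value_words_subset: "0 < k \<Longrightarrow> word_value g ` words D k \<subseteq> C \<inter> {0..<g ^ k}"
  using word_value_less_power by (auto simp: cantor_set_eq words_def)

text \<open>A word of value at least \<open>g ^ j\<close> has more than \<open>j\<close> letters, so
  cutting off the \<open>j\<close> lowest ones leaves a nonempty word, whose value is again in
  \<open>C\<close>.\<close>

lemma cantor_set_cases: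
  assumes "n \<in> C" "g ^ j \<le> n"
  obtains v u where "v \<in> words D j" "u \<in> C" "n = word_value g v + g ^ j * u"
proof -
  obtain w where w: "n = word_value g w" "set w \<subseteq> D" using assms by (auto simp: cantor_set_eq)
  have "g ^ j < g ^ length w" using assms(2) word_value_less[of w g] w digits by force
  then have "j < length w" using base by simp
  then have "take j w \<in> words D j" "drop j w \<noteq> []" "set (drop j w) \<subseteq> D"
    using w(2) set_take_subset[of j w] set_drop_subset[of j w] by (auto simp: words_def)
  moreover have "n = word_value g (take j w) + g ^ j * word_value g (drop j w)"
    using word_value_append[of g "take j w" "drop j w"] w \<open>j < length w\<close> by simp
  ultimately show ?thesis using that[of "take j w" "word_value g (drop j w)"]
    by (simp add: cantor_set_eq)
qed

lemma cantor_set_between_powers: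
  "C \<inter> {g ^ j..<g ^ Suc j} \<subseteq> word_value g ` words D (Suc j)"
proof
  fix n assume n: "n \<in> C \<inter> {g ^ j..<g ^ Suc j}"
  then obtain v u where vu: "v \<in> words D j" "u \<in> C" "n = word_value g v + g ^ j * u"
    using cantor_set_cases[of n j] by auto
  obtain x w where xw: "u = word_value g (x # w)" "x \<in> D"
    using vu(2) by (auto simp: cantor_set_eq neq_Nil_conv)
  have "g ^ j * u \<le> n" "n < g ^ j * g" using n vu(3) by (simp_all add: mult.commute)
  then have "g ^ j * u < g ^ j * g" by (rule le_less_trans)
  then have "u < g" by simp
  then have "word_value g w = 0" using xw(1) by (cases "word_value g w") auto
  then have "n = word_value g (v @ [x])" using vu xw by (auto simp: words_def)
  moreover have "v @ [x] \<in> words D (Suc j)" using vu xw by (auto simp: words_def)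
  ultimately show "n \<in> word_value g ` words D (Suc j)" by blast
qed

lemma card_cantor_set_Suc_le:
  "card (C \<inter> {0..<g ^ Suc j}) \<le> card (C \<inter> {0..<g ^ j}) + t ^ Suc j"
proof -
  have "C \<inter> {0..<g ^ Suc j} \<subseteq> (C \<inter> {0..<g ^ j}) \<union> word_value g ` words D (Suc j)"
    using cantor_set_between_powers[of j] by auto
  then have "card (C \<inter> {0..<g ^ Suc j}) \<le> card ((C \<inter> {0..<g ^ j}) \<union> word_value g ` words D (Suc j))"
    by (intro card_mono) (auto simp: finite_words)
  also have "\<dots> \<le> card (C \<inter> {0..<g ^ j}) + card (word_value g ` words D (Suc j))"
    by (rule card_Un_le)
  also have "card (word_value g ` words D (Suc j)) = t ^ Suc j"
    by (simp only: card_image[OF inj_on_word_value] card_words)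
  finally show ?thesis by simp
qed

lemma card_cantor_set_le: "card (C \<inter> {0..<g ^ j}) \<le> 2 * t ^ j"
proof (induction j)
  case 0
  have "card (C \<inter> {0..<1}) \<le> card {0::nat}" by (intro card_mono) auto
  then show ?case by simp
next
  case (Suc j)
  have "2 * t ^ j \<le> t ^ Suc j" using two_digits by simp
  then show ?case using Suc card_cantor_set_Suc_le[of j] by linarith
qed

text \<open>Putting a fixed nonzero digit on top of each word of length \<open>j\<close> yields
  \<open>t ^ j\<close> distinct points that are at least \<open>g ^ j\<close>. With the upper bound
  \<open>2 * t ^ j\<close> this gives growth by a factor of at least 3/2.\<close>

lemma card_cantor_set_Suc_ge:
  "card (C \<inter> {0..<g ^ j}) + t ^ j \<le> card (C \<inter> {0..<g ^ Suc j})"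
proof -
  have "\<not> D \<subseteq> {0}"
  proof
    assume "D \<subseteq> {0}"
    then have "card D \<le> card {0::nat}" by (intro card_mono) auto
    then show False using two_digits by simp
  qed
  then obtain e where e: "e \<in> D" "e > 0" by auto
  define f where "f = (\<lambda>v. word_value g (v @ [e]))"
  have f: "f v = word_value g v + g ^ j * e" if "v \<in> words D j" for v
    using that by (simp add: f_def words_def)
  have "inj_on f (words D j)"
    using inj_on_word_value[of j] by (simp add: inj_on_def f)
  then have c: "card (f ` words D j) = t ^ j" by (simp add: card_image card_words)
  have sub: "f ` words D j \<subseteq> C \<inter> {0..<g ^ Suc j}"
  proof -
    have "f ` words D j \<subseteq> word_value g ` words D (Suc j)"
      using e by (auto simp: f_def words_def simp del: word_value_append intro!: imageI)
    then show ?thesis using word_value_words_subset[of "Suc j"] by auto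
  qed
  have "g ^ j \<le> f v" if "v \<in> words D j" for v
  proof -
    have "g ^ j * 1 \<le> g ^ j * e" using e by (intro mult_le_mono2) auto
    then show ?thesis using f[OF that] by linarith
  qed
  then have disj: "(C \<inter> {0..<g ^ j}) \<inter> f ` words D j = {}" by fastforce
  have "g ^ j \<le> g ^ Suc j" using base by (intro power_increasing) auto
  then have "C \<inter> {0..<g ^ j} \<subseteq> C \<inter> {0..<g ^ Suc j}"
    by (intro Int_mono) auto
  then have "card ((C \<inter> {0..<g ^ j}) \<union> f ` words D j) \<le> card (C \<inter> {0..<g ^ Suc j})"
    using sub by (intro card_mono) auto
  then show ?thesis using disj c by (subst (asm) card_Un_disjoint) (auto simp: finite_words)
qed

lemma card_cantor_set_ge_power: "t ^ k \<le> card (C \<inter> {0..<g ^ Suc k})"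
  using card_cantor_set_Suc_ge[of k] by simp

lemma filterlim_card_cantor_set: "filterlim (\<lambda>N. real (card (C \<inter> {0..<N}))) at_top sequentially"
  unfolding filterlim_at_top eventually_sequentially
proof
  fix Z :: real
  obtain k where k: "Z < 2 ^ k"
    using real_arch_pow[of 2 Z] by auto
  have "Z \<le> real (card (C \<inter> {0..<N}))" if "N \<ge> g ^ Suc k" for N
  proof -
    have "Z \<le> real t ^ k" using k power_mono[of 2 "real t" k] two_digits by linarith
    also have "\<dots> \<le> real (card (C \<inter> {0..<g ^ Suc k}))"
      using card_cantor_set_ge_power[of k] by (metis of_nat_le_iff of_nat_power)
    also have "card (C \<inter> {0..<g ^ Suc k}) \<le> card (C \<inter> {0..<N})"
      using that by (intro card_mono) auto
    finally show ?thesis by simp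
  qed
  then show "\<exists>M. \<forall>N\<ge>M. Z \<le> real (card (C \<inter> {0..<N}))" by blast
qed

end


section \<open>Classes met by words of every large length\<close>

text \<open>The residues are integers, so that a class can be shifted by subtraction without
  truncation.\<close>

definition in_class :: "nat \<Rightarrow> nat \<Rightarrow> nat \<Rightarrow> int \<Rightarrow> int \<Rightarrow> nat list \<Rightarrow> bool" where
  "in_class g a a' b b' w \<longleftrightarrow>
     [int (word_value g w) = b] (mod int a) \<and> [int (sum_list w) = b'] (mod int a')"

lemma in_class_int_iff:
  "in_class g a a' (int b) (int b') w \<longleftrightarrow>
     word_value g w mod a = b mod a \<and> sum_list w mod a' = b' mod a'"
  unfolding in_class_def cong_int_iff unfolding cong_def ..

text \<open>Were no word of length \<open>k + 1\<close> in the class, the class would gain no points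
  between \<open>g ^ k\<close> and \<open>g ^ (k + 1)\<close>, while \<open>C\<close> grows by a
  factor of at least 3/2. For large \<open>k\<close> this contradicts convergence of the quotient to
  a positive limit.\<close>

lemma (in digit_set) eventually_in_class:
  assumes unif: "jointly_unif_distributed g C a a'" and pos: "0 < a" "0 < a'"
  shows "\<forall>\<^sub>F k in sequentially. \<exists>w\<in>words D k. in_class g a a' (int b) (int b') w"
proof -
  define X where
    "X = {n \<in> C. [n = b mod a] (mod a) \<and> [digit_sum g n = b' mod a'] (mod a')}"
  define A where "A = (\<lambda>k. real (card (C \<inter> {0..<g ^ k})))"
  define B where "B = (\<lambda>k. real (card (X \<inter> {0..<g ^ k})))"
  define \<mu> where "\<mu> = 1 / (real a * real a')"
  have "\<mu> > 0" using pos by (simp add: \<mu>_def)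
  have "(\<lambda>N. real (card (X \<inter> {0..<N})) / real (card (C \<inter> {0..<N}))) \<longlonglongrightarrow> \<mu>"
    using unif pos unfolding jointly_unif_distributed_def X_def \<mu>_def
    by (meson mod_less_divisor)
  moreover have "strict_mono (\<lambda>k. g ^ k)"
    using base by (intro strict_monoI power_strict_increasing) auto
  ultimately have lim: "(\<lambda>k. B k / A k) \<longlonglongrightarrow> \<mu>"
    unfolding A_def B_def by (auto dest: LIMSEQ_subseq_LIMSEQ simp: o_def)
  \<comment> \<open>A relative error of 1/10 suffices: the two quotients compared below then differ
    by a factor of at most 11/9, which is less than 3/2.\<close>
  then have "\<forall>\<^sub>F k in sequentially. dist (B k / A k) \<mu> < \<mu> / 10"
    using \<open>\<mu> > 0\<close> by (intro tendstoD) auto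
  then obtain k0 where k0: "\<And>k. k \<ge> k0 \<Longrightarrow> \<bar>B k / A k - \<mu>\<bar> < \<mu> / 10"
    by (auto simp: eventually_sequentially dist_real_def)
  \<comment> \<open>The bound \<open>Suc k0\<close> keeps \<open>k\<close> positive;
    \<open>A 0\<close> vanishes when 0 is not a digit, and the quotient would then be
    meaningless.\<close>
  have "\<exists>w\<in>words D (Suc k). in_class g a a' (int b) (int b') w" if "k \<ge> Suc k0" for k
  proof (rule ccontr)
    assume none: "\<not> ?thesis"
    have "X \<inter> {0..<g ^ Suc k} \<subseteq> X \<inter> {0..<g ^ k}"
    proof
      fix n assume n: "n \<in> X \<inter> {0..<g ^ Suc k}"
      have "n < g ^ k"
      proof (rule ccontr)
        assume "\<not> n < g ^ k"
        then have "n \<in> word_value g ` words D (Suc k)"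
          using cantor_set_between_powers[of k] n by (auto simp: X_def)
        then obtain w where w: "w \<in> words D (Suc k)" "n = word_value g w" by auto
        then have "digit_sum g n = sum_list w"
          using digit_sum_word_value[of g w] base digits by (auto simp: words_def)
        then have "in_class g a a' (int b) (int b') w"
          using n w(2) by (simp add: X_def in_class_int_iff cong_def)
        then show False using none w(1) by blast
      qed
      then show "n \<in> X \<inter> {0..<g ^ k}" using n by auto
    qed
    then have B: "B (Suc k) \<le> B k" unfolding B_def by (simp add: card_mono)
    have "2 * card (C \<inter> {0..<g ^ Suc k}) \<ge> 3 * card (C \<inter> {0..<g ^ k})"
      using card_cantor_set_Suc_ge[of k] card_cantor_set_le[of k] by linarith
    then have "real (3 * card (C \<inter> {0..<g ^ k})) \<le> real (2 * card (C \<inter> {0..<g ^ Suc k}))"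
      using of_nat_le_iff by blast
    then have A: "3 * A k \<le> 2 * A (Suc k)" by (simp add: A_def)
    have "B k / A k \<le> 11 / 10 * \<mu>" "B (Suc k) / A (Suc k) \<ge> 9 / 10 * \<mu>"
      using k0[of k] k0[of "Suc k"] that by linarith+
    moreover have "0 < A k"
    proof -
      obtain i where "k = Suc i" using \<open>k \<ge> Suc k0\<close> by (cases k) auto
      moreover have "0 < t ^ i" using two_digits by simp
      ultimately show ?thesis using card_cantor_set_ge_power[of i] unfolding A_def
        by (metis of_nat_0_less_iff less_le_trans)
    qed
    moreover have "0 < A (Suc k)" using A \<open>0 < A k\<close> by linarith
    ultimately have "B k \<le> 11 / 10 * \<mu> * A k" "9 / 10 * \<mu> * A (Suc k) \<le> B (Suc k)"
      by (simp_all add: pos_divide_le_eq pos_le_divide_eq)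
    then have "9 / 10 * \<mu> * A (Suc k) \<le> 11 / 10 * \<mu> * A k" using B by linarith
    then have "9 * A (Suc k) \<le> 11 * A k" using \<open>\<mu> > 0\<close> by simp
    then show False using A \<open>0 < A k\<close> by linarith
  qed
  then have "\<exists>w\<in>words D k. in_class g a a' (int b) (int b') w" if "k \<ge> Suc (Suc k0)" for k
    using that by (cases k) auto
  then show ?thesis unfolding eventually_sequentially by blast
qed

lemma (in digit_set) words_value_cong:
  assumes "w \<in> words D k" "w' \<in> words D k" "\<And>x y. x \<in> D \<Longrightarrow> y \<in> D \<Longrightarrow> [x = y] (mod q)"
  shows "[word_value g w = word_value g w'] (mod q)"
proof -
  have "length w = length w'" "set w \<subseteq> D" "set w' \<subseteq> D" using assms(1,2) by (auto simp: words_def)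
  then show ?thesis
    by (induction w w' rule: list_induct2) (auto intro: cong_add cong_scalar_left assms(3))
qed

section \<open>Concatenation as addition of classes\<close>

locale digit_walk = digit_set +
  fixes a a' p :: nat
  assumes pos: "0 < a" "0 < a'" and coprime: "coprime g a"
    and p: "p = a' * totient (a * (g - 1))"
begin

abbreviation cls where "cls \<equiv> in_class g a a'"

lemma p_pos: "0 < p"
  using pos base by (simp add: p)

text \<open>Euler's theorem for the modulus \<open>a * (g - 1)\<close>: \<open>g\<close> is coprime
  to \<open>a\<close> by assumption and to its predecessor \<open>g - 1\<close>.\<close>

lemma power_cong_1: "p dvd k \<Longrightarrow> [g ^ k = 1] (mod (a * (g - 1)))"
proof -
  assume "p dvd k"
  then have "totient (a * (g - 1)) dvd k" unfolding p by (rule dvd_mult_right)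
  then obtain c where k: "k = totient (a * (g - 1)) * c" by (rule dvdE)
  have "coprime g (g - 1)" using base by (metis coprime_diff_one_right_nat less_le_trans pos2)
  then have "[g ^ totient (a * (g - 1)) = 1] (mod (a * (g - 1)))"
    using coprime by (intro euler_theorem) simp
  then have "[(g ^ totient (a * (g - 1))) ^ c = 1 ^ c] (mod (a * (g - 1)))"
    by (rule cong_pow)
  then show ?thesis by (simp add: k power_mult)
qed

text \<open>The value is the geometric sum \<open>d * (g ^ k - 1) / (g - 1)\<close>. Cancelling
  \<open>g - 1\<close> is the reason for working modulo \<open>a * (g - 1)\<close> and not just
  modulo \<open>a\<close>.\<close>

lemma word_value_replicate:
  assumes "p dvd k"
  shows "[word_value g (replicate k d) = 0] (mod a)"
proof -
  have "(g - 1) * word_value g (replicate k d) + d = d * g ^ k"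
  proof (induction k)
    case (Suc k)
    obtain h where "g = Suc h" using base by (cases g) auto
    then have "(g - 1) * word_value g (replicate (Suc k) d) + d =
        g * ((g - 1) * word_value g (replicate k d) + d)"
      by (simp add: algebra_simps)
    then show ?case by (simp only: Suc.IH power_Suc mult.left_commute)
  qed simp
  then have "(g - 1) * word_value g (replicate k d) = d * (g ^ k - 1)"
    by (simp add: diff_mult_distrib2)
  moreover have "a * (g - 1) dvd g ^ k - 1"
    using power_cong_1[OF assms] base by (simp add: cong_altdef_nat)
  ultimately have "(g - 1) * a dvd (g - 1) * word_value g (replicate k d)"
    by (simp add: mult.commute)
  then show ?thesis using base by (simp add: cong_0_iff)
qed

text \<open>The digit sum \<open>k * d\<close> vanishes modulo \<open>a'\<close> because of the
  factor \<open>a'\<close> in \<open>p\<close>. Constant words thus serve as neutral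
  padding.\<close>

lemma cls_replicate: "p dvd k \<Longrightarrow> cls 0 0 (replicate k d)"
  using word_value_replicate[of k d] dvd_trans[of a' p k]
  by (simp add: in_class_def cong_0_iff sum_list_replicate p)

lemma word_value_append_cong:
  assumes "p dvd length u"
  shows "[word_value g (u @ w) = word_value g u + word_value g w] (mod a)"
proof -
  have "[g ^ length u = 1] (mod a)"
    using power_cong_1[OF assms] cong_modulus_mult_nat by blast
  then have "[word_value g u + g ^ length u * word_value g w = word_value g u + 1 * word_value g w] (mod a)"
    by (intro cong_add cong_mult cong_refl)
  then show ?thesis by simp
qed

lemma cls_append_iff:
  assumes "p dvd length u"
  shows "cls b b' (u @ w) \<longleftrightarrow> cls (b - int (word_value g w)) (b' - int (sum_list w)) u"
proof -
  have "[int (word_value g (u @ w)) = int (word_value g u + word_value g w)] (mod int a)"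
    using word_value_append_cong[OF assms] by (simp only: cong_int_iff)
  then have "[int (word_value g (u @ w)) = b] (mod int a) \<longleftrightarrow>
      [int (word_value g u + word_value g w) = b] (mod int a)"
    using cong_trans cong_sym by blast
  then show ?thesis
    by (simp only: in_class_def) (simp add: cong_iff_dvd_diff algebra_simps)
qed

lemma cls_append:
  assumes "p dvd length u" "cls b b' u" "cls c c' w"
  shows "cls (b + c) (b' + c') (u @ w)"
proof -
  have "[b = b + c - int (word_value g w)] (mod int a)"
    "[b' = b' + c' - int (sum_list w)] (mod int a')"
    using assms(3) by (auto simp: in_class_def cong_iff_dvd_diff dvd_diff_commute)
  then show ?thesis
    using assms(2) unfolding cls_append_iff[OF assms(1)]
    unfolding in_class_def by (blast intro: cong_trans)
qed

section \<open>Equidistribution of class frequencies\<close>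

definition prob :: "nat \<Rightarrow> int \<Rightarrow> int \<Rightarrow> real" where
  "prob k b b' = real (card {w \<in> words D k. cls b b' w}) / real t ^ k"

lemma card_class: "real (card {w \<in> words D k. cls b b' w}) = prob k b b' * real t ^ k"
  using two_digits by (simp add: prob_def)

text \<open>Conditioning on the upper \<open>k\<close> letters: the frequencies for length
  \<open>j + k\<close> are averages of shifted frequencies for length \<open>j\<close>, as for a
  step of a random walk.\<close>

lemma prob_add:
  assumes "p dvd j"
  shows "prob (j + k) b b' =
    (\<Sum>w\<in>words D k. prob j (b - int (word_value g w)) (b' - int (sum_list w))) / real t ^ k"
proof -
  define S where "S = (SIGMA w:words D k.
    {u \<in> words D j. cls (b - int (word_value g w)) (b' - int (sum_list w)) u})"
  have "inj_on (\<lambda>(w, u). u @ w) S"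
    by (auto simp: S_def inj_on_def words_def)
  moreover have "{x \<in> words D (j + k). cls b b' x} = (\<lambda>(w, u). u @ w) ` S"
  proof (intro equalityI subsetI)
    fix x assume x: "x \<in> {x \<in> words D (j + k). cls b b' x}"
    have "take j x \<in> words D j" "drop j x \<in> words D k"
      using x set_take_subset[of j x] set_drop_subset[of j x] by (auto simp: words_def)
    moreover have "cls b b' (take j x @ drop j x)" using x by simp
    ultimately have "(drop j x, take j x) \<in> S"
      using assms by (subst (asm) cls_append_iff) (auto simp: S_def words_def)
    then show "x \<in> (\<lambda>(w, u). u @ w) ` S" by force
  next
    fix x assume "x \<in> (\<lambda>(w, u). u @ w) ` S"
    then show "x \<in> {x \<in> words D (j + k). cls b b' x}"
      using assms by (auto simp: S_def words_def cls_append_iff)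
  qed
  ultimately have "card {x \<in> words D (j + k). cls b b' x} = card S"
    by (simp add: card_image)
  also have "\<dots> = (\<Sum>w\<in>words D k.
      card {u \<in> words D j. cls (b - int (word_value g w)) (b' - int (sum_list w)) u})"
    unfolding S_def by (rule card_SigmaI) (auto simp: finite_words)
  finally have "real (card {x \<in> words D (j + k). cls b b' x}) = (\<Sum>w\<in>words D k.
      prob j (b - int (word_value g w)) (b' - int (sum_list w))) * real t ^ j"
    by (simp add: card_class sum_distrib_right)
  then show ?thesis
    using two_digits by (simp add: prob_def[of "j + k"] power_add)
qed

lemma prob_nonneg: "0 \<le> prob k b b'"
  by (simp add: prob_def)

lemma prob_le_1: "prob k b b' \<le> 1"
proof -
  have "card {w \<in> words D k. cls b b' w} \<le> t ^ k"
    unfolding card_words[symmetric] by (intro card_mono finite_words) auto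
  then have "real (card {w \<in> words D k. cls b b' w}) \<le> real (t ^ k)"
    by (simp only: of_nat_le_iff)
  then show ?thesis using two_digits by (simp add: prob_def)
qed

lemma prob_cong:
  assumes "[b = c] (mod int a)" "[b' = c'] (mod int a')"
  shows "prob k b b' = prob k c c'"
proof -
  have "cls b b' = cls c c'"
    using assms by (auto simp: in_class_def fun_eq_iff intro: cong_trans cong_sym)
  then show ?thesis by (simp add: prob_def)
qed

lemma sum_prob: "(\<Sum>(b, b')\<in>{..<a} \<times> {..<a'}. prob k (int b) (int b')) = 1"
proof -
  let ?r = "\<lambda>w. (word_value g w mod a, sum_list w mod a')"
  have "?r w = (b, b') \<longleftrightarrow> cls (int b) (int b') w" if "b < a" "b' < a'" for b b' w
    using that by (simp add: in_class_int_iff)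
  then have "prob k (int b) (int b') = (\<Sum>w\<in>{w \<in> words D k. ?r w = (b, b')}. 1 / real t ^ k)"
    if "b < a" "b' < a'" for b b'
    using that by (simp add: prob_def)
  then have "(\<Sum>(b, b')\<in>{..<a} \<times> {..<a'}. prob k (int b) (int b')) =
      (\<Sum>y\<in>{..<a} \<times> {..<a'}. \<Sum>w\<in>{w \<in> words D k. ?r w = y}. 1 / real t ^ k)"
    by (intro sum.cong) auto
  also have "\<dots> = (\<Sum>w\<in>words D k. 1 / real t ^ k)"
    using pos by (intro sum.group) (auto simp: finite_words)
  also have "\<dots> = 1" using two_digits by (simp add: card_words)
  finally show ?thesis .
qed

text \<open>By \<open>prob_add\<close> both frequencies are averages of \<open>t ^ k\<close> earlier
  ones. As every class contains a word of length \<open>k\<close>, one pair of terms can be made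
  equal, and only \<open>t ^ k - 1\<close> differences remain to be bounded by induction.\<close>

lemma prob_spread:
  assumes "p dvd k" and all: "\<And>b b'. \<exists>w\<in>words D k. cls b b' w"
  shows "prob (q * k) b b' - prob (q * k) c c' \<le> (1 - 1 / real t ^ k) ^ q"
proof (induction q arbitrary: b b' c c')
  case 0
  show ?case using prob_le_1[of 0 b b'] prob_nonneg[of 0 c c'] by simp
next
  case (Suc q)
  define r where "r = 1 - 1 / real t ^ k"
  have t: "real t ^ k > 0" using two_digits by simp
  define F where "F b b' w = prob (q * k) (b - int (word_value g w)) (b' - int (sum_list w))"
    for b b' w
  obtain v where v: "v \<in> words D k" "cls b b' v" using all by blast
  obtain w where w: "w \<in> words D k" "cls c c' w" using all by blast
  \<comment> \<open>The words \<open>v\<close> and \<open>w\<close> move the two classes to the same class \<open>(0, 0)\<close>, so their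
    contributions cancel.\<close>
  have "F b b' v = prob (q * k) 0 0" "F c c' w = prob (q * k) 0 0"
    using v(2) w(2) unfolding F_def in_class_def
    by (auto intro!: prob_cong simp: cong_iff_dvd_diff dvd_diff_commute)
  then have vw: "F b b' v = F c c' w" by simp
  have card: "card (words D k - {x}) = t ^ k - 1" if "x \<in> words D k" for x
    using that by (simp add: finite_words card_words)
  \<comment> \<open>Any pairing of the remaining words will do, since the induction hypothesis
    bounds the difference for arbitrary pairs of classes.\<close>
  obtain h where h: "bij_betw h (words D k - {v}) (words D k - {w})"
    using finite_same_card_bij[of "words D k - {v}" "words D k - {w}"] card[OF v(1)] card[OF w(1)]
    by (auto simp: finite_words)
  have "(\<Sum>x\<in>words D k. F b b' x) - (\<Sum>x\<in>words D k. F c c' x) =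
      (\<Sum>x\<in>words D k - {v}. F b b' x) - (\<Sum>x\<in>words D k - {w}. F c c' x)"
    using sum.remove[OF finite_words v(1), of "F b b'"] sum.remove[OF finite_words w(1), of "F c c'"] vw
    by simp
  also have "\<dots> = (\<Sum>x\<in>words D k - {v}. F b b' x - F c c' (h x))"
    by (simp add: sum_subtractf sum.reindex_bij_betw[OF h])
  also have "\<dots> \<le> (\<Sum>x\<in>words D k - {v}. r ^ q)"
    unfolding F_def r_def by (intro sum_mono Suc.IH)
  also have "\<dots> = (real t ^ k - 1) * r ^ q"
    using two_digits by (simp add: card[OF v(1)] of_nat_diff)
  finally have "((\<Sum>x\<in>words D k. F b b' x) - (\<Sum>x\<in>words D k. F c c' x)) / real t ^ k \<le>
      (real t ^ k - 1) * r ^ q / real t ^ k"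
    using t by (intro divide_right_mono) auto
  also have "(real t ^ k - 1) * r ^ q / real t ^ k = r ^ Suc q"
    using t by (simp add: r_def field_simps)
  finally have "prob (q * k + k) b b' - prob (q * k + k) c c' \<le> r ^ Suc q"
    using assms(1) by (simp add: prob_add F_def diff_divide_distrib)
  then show ?case by (simp add: r_def add.commute)
qed

text \<open>The frequencies of the \<open>a * a'\<close> classes sum to 1, so their mean is
  \<open>1 / (a * a')\<close>; a small spread forces each of them close to this mean.\<close>

lemma prob_equidistributed:
  assumes "p dvd k" and "\<And>b b'. \<exists>w\<in>words D k. cls b b' w" and "0 < e"
  obtains K where "\<And>b b'. \<bar>prob K b b' - 1 / (real a * real a')\<bar> \<le> e"
proof -
  have "1 \<le> real t ^ k" using two_digits by (intro one_le_power) simp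
  then have "1 - 1 / real t ^ k < 1" using two_digits by simp
  then obtain q where q: "(1 - 1 / real t ^ k) ^ q < e"
    using real_arch_pow_inv[OF \<open>0 < e\<close>] by blast
  define K where "K = q * k"
  have spread: "\<bar>prob K b b' - prob K c c'\<bar> \<le> e" for b b' c c'
    using prob_spread[OF assms(1,2), of q b b' c c'] prob_spread[OF assms(1,2), of q c c' b b'] q
    unfolding K_def by linarith
  have "\<bar>prob K b b' - 1 / (real a * real a')\<bar> \<le> e" for b b'
  proof -
    let ?I = "{..<a} \<times> {..<a'}"
    have "(\<Sum>y\<in>?I. prob K b b' - prob K (int (fst y)) (int (snd y))) =
        real a * real a' * prob K b b' - 1"
      using sum_prob[of K] by (simp add: sum_subtractf card_cartesian_product case_prod_beta)
    moreover have "\<bar>\<Sum>y\<in>?I. prob K b b' - prob K (int (fst y)) (int (snd y))\<bar> \<le> (\<Sum>y\<in>?I. e)"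
      by (rule order_trans[OF sum_abs sum_mono]) (rule spread)
    ultimately have "\<bar>real a * real a' * prob K b b' - 1\<bar> \<le> real a * real a' * e"
      by (simp add: card_cartesian_product)
    moreover have "real a * real a' * prob K b b' - 1 =
        real a * real a' * (prob K b b' - 1 / (real a * real a'))"
      using pos by (simp add: field_simps)
    ultimately show ?thesis using pos by (simp add: abs_mult)
  qed
  then show ?thesis using that by blast
qed

end

section \<open>From words to initial segments of the Cantor set\<close>

text \<open>Each \<open>u\<close> in \<open>U\<close> carries a complete block of points sharing the
  upper part \<open>u\<close>. Missed are at most the numbers below \<open>g ^ K\<close>, which may
  have no upper part in \<open>C\<close>, and those of the incomplete last block:
  \<open>g ^ K\<close> numbers each.\<close>

lemma (in digit_set) card_cantor_set_blocks:
  fixes P :: "nat \<Rightarrow> bool" and N K :: nat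
  defines "U \<equiv> C \<inter> {0..<N div g ^ K}"
  defines "S \<equiv> (\<Sum>u\<in>U. card {v \<in> words D K. P (word_value g v + g ^ K * u)})"
  shows "S \<le> card {n \<in> C \<inter> {0..<N}. P n}"
    and "card {n \<in> C \<inter> {0..<N}. P n} \<le> S + 2 * g ^ K"
proof -
  define M where "M = N div g ^ K"
  define f where "f = (\<lambda>(u, v). word_value g v + g ^ K * u)"
  define T where "T = (SIGMA u:U. {v \<in> words D K. P (word_value g v + g ^ K * u)})"
  have "0 < g ^ K" using base by simp
  have "inj_on f T"
  proof (rule inj_onI)
    fix x y assume xy: "x \<in> T" "y \<in> T" "f x = f y"
    obtain u v u' v' where [simp]: "x = (u, v)" "y = (u', v')" by (cases x; cases y)
    have v: "v \<in> words D K" "v' \<in> words D K" using xy by (auto simp: T_def)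
    have eq: "word_value g v + g ^ K * u = word_value g v' + g ^ K * u'"
      using xy(3) by (simp add: f_def)
    have "word_value g v = word_value g v'"
      using arg_cong[OF eq, of "\<lambda>n. n mod g ^ K"] word_value_less_power[OF v(1)]
        word_value_less_power[OF v(2)] by simp
    moreover from this have "u = u'" using eq base by simp
    ultimately show "x = y" using inj_on_word_value[of K] v by (simp add: inj_on_def)
  qed
  have "finite T" unfolding T_def U_def by (auto simp: finite_words)
  have "card (f ` T) = card T" using \<open>inj_on f T\<close> by (rule card_image)
  also have "\<dots> = S" unfolding T_def S_def by (rule card_SigmaI) (auto simp: U_def finite_words)
  finally have S: "card (f ` T) = S" .
  have sub: "f ` T \<subseteq> {n \<in> C \<inter> {0..<N}. P n}"
  proof
    fix n assume "n \<in> f ` T"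
    then obtain u v where uv: "n = word_value g v + g ^ K * u" "u \<in> C" "u < M" "v \<in> words D K" "P n"
      by (auto simp: f_def T_def U_def M_def)
    obtain w where w: "u = word_value g w" "w \<noteq> []" "set w \<subseteq> D"
      using uv(2) by (auto simp: cantor_set_eq)
    have "n = word_value g (v @ w)" "v @ w \<noteq> []" "set (v @ w) \<subseteq> D"
      using uv w by (auto simp: words_def)
    then have "n \<in> C" unfolding cantor_set_eq by blast
    have "n < g ^ K * Suc u" using uv(1) word_value_less_power[OF uv(4)] by simp
    also have "\<dots> \<le> g ^ K * M" using uv(3) by (intro mult_le_mono2) simp
    also have "\<dots> \<le> N" by (simp add: M_def)
    finally show "n \<in> {n \<in> C \<inter> {0..<N}. P n}" using \<open>n \<in> C\<close> uv(5) by simp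
  qed
  show "S \<le> card {n \<in> C \<inter> {0..<N}. P n}"
    unfolding S[symmetric] by (intro card_mono sub) auto
  have "{n \<in> C \<inter> {0..<N}. P n} \<subseteq> f ` T \<union> ({0..<g ^ K} \<union> {g ^ K * M..<g ^ K * M + g ^ K})"
  proof
    fix n assume n: "n \<in> {n \<in> C \<inter> {0..<N}. P n}"
    show "n \<in> f ` T \<union> ({0..<g ^ K} \<union> {g ^ K * M..<g ^ K * M + g ^ K})"
    proof (cases "g ^ K \<le> n \<and> n < g ^ K * M")
      case True
      then obtain v u where vu: "v \<in> words D K" "u \<in> C" "n = word_value g v + g ^ K * u"
        using cantor_set_cases[of n K] n by auto
      have "g ^ K * u < g ^ K * M" using vu(3) True by linarith
      then have "(u, v) \<in> T" using vu n by (simp add: T_def U_def M_def)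
      moreover have "n = f (u, v)" using vu by (simp add: f_def)
      ultimately show ?thesis by blast
    next
      case False
      have "N = g ^ K * M + N mod g ^ K" by (simp add: M_def)
      moreover have "N mod g ^ K < g ^ K" using \<open>0 < g ^ K\<close> by simp
      ultimately have "n < g ^ K * M + g ^ K" using n by simp
      then show ?thesis using False by auto
    qed
  qed
  then have "card {n \<in> C \<inter> {0..<N}. P n} \<le>
      card (f ` T \<union> ({0..<g ^ K} \<union> {g ^ K * M..<g ^ K * M + g ^ K}))"
    using \<open>finite T\<close> by (intro card_mono) auto
  also have "\<dots> \<le> card (f ` T) + (card {0..<g ^ K} + card {g ^ K * M..<g ^ K * M + g ^ K})"
    by (intro order_trans[OF card_Un_le] add_left_mono card_Un_le)
  finally show "card {n \<in> C \<inter> {0..<N}. P n} \<le> S + 2 * g ^ K" by (simp add: S)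
qed

context digit_walk
begin

text \<open>A fixed upper part \<open>u\<close> merely shifts the class required of
  \<open>v\<close>, so the uniform estimate over all classes applies to every block.\<close>

lemma cls_add_iff:
  assumes "v \<in> words D K" "u \<in> C"
  shows "[word_value g v + g ^ K * u = b] (mod a) \<and>
      [digit_sum g (word_value g v + g ^ K * u) = b'] (mod a') \<longleftrightarrow>
    cls (int b - int (g ^ K * u)) (int b' - int (digit_sum g u)) v"
proof -
  obtain w where w: "u = word_value g w" "set w \<subseteq> D" using assms(2) by (auto simp: cantor_set_eq)
  have "digit_sum g (word_value g (v @ w)) = sum_list (v @ w)"
    using assms(1) w(2) digits base by (intro digit_sum_word_value) (auto simp: words_def)
  moreover have "digit_sum g u = sum_list w"
    using w digits base by (auto intro: digit_sum_word_value)
  ultimately have "digit_sum g (word_value g v + g ^ K * u) = sum_list v + digit_sum g u"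
    using assms(1) w(1) by (simp add: words_def)
  then show ?thesis
    unfolding in_class_def cong_int_iff[symmetric] cong_iff_dvd_diff by (simp add: algebra_simps)
qed

lemma jointly_unif_distributedI:
  assumes "p dvd k" and "\<And>b b'. \<exists>w\<in>words D k. cls b b' w"
  shows "jointly_unif_distributed g C a a'"
  unfolding jointly_unif_distributed_def
proof (intro allI impI)
  fix b b' assume "b < a" "b' < a'"
  define P where "P = (\<lambda>n. [n = b] (mod a) \<and> [digit_sum g n = b'] (mod a'))"
  define A where "A = (\<lambda>N. real (card (C \<inter> {0..<N})))"
  define B where "B = (\<lambda>N. real (card {n \<in> C \<inter> {0..<N}. P n}))"
  define \<mu> where "\<mu> = 1 / (real a * real a')"
  have \<mu>: "0 \<le> \<mu>" "\<mu> \<le> 1"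
  proof -
    have "1 * 1 \<le> real a * real a'" using pos by (intro mult_mono) auto
    then show "\<mu> \<le> 1" by (simp add: \<mu>_def)
  qed (simp add: \<mu>_def)
  have eq: "{n \<in> C. P n} \<inter> {0..<N} = {n \<in> C \<inter> {0..<N}. P n}" for P N by auto
  have "(\<lambda>N. B N / A N) \<longlonglongrightarrow> \<mu>"
  proof (rule tendstoI)
    fix e :: real assume "0 < e"
    then obtain K where K: "\<And>b b'. \<bar>prob K b b' - \<mu>\<bar> \<le> e / 4"
      using prob_equidistributed[OF assms, of "e / 4"] unfolding \<mu>_def by auto
    define G where "G = 2 * real g ^ K"
    \<comment> \<open>The threshold makes \<open>A N\<close> positive and the boundary error
      \<open>G\<close> smaller than \<open>e / 4 * A N\<close>; the blocks contribute at most
      another \<open>e / 4 * A N\<close>.\<close>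
    have "dist (B N / A N) \<mu> < e" if "A N > max 0 (4 * G / e)" for N
    proof -
      define U where "U = C \<inter> {0..<N div g ^ K}"
      define S where "S = (\<Sum>u\<in>U. real (card {v \<in> words D K. P (word_value g v + g ^ K * u)}))"
      define T where "T = real (card U) * real t ^ K"
      \<comment> \<open>The block count with the trivial predicate estimates the denominator, with
        the same boundary error as the numerator.\<close>
      have "real (\<Sum>u\<in>U. card (words D K)) \<le> A N"
        "A N \<le> real ((\<Sum>u\<in>U. card (words D K)) + 2 * g ^ K)"
        using card_cantor_set_blocks[where N = N and K = K and P = "\<lambda>_. True"]
        unfolding A_def U_def of_nat_le_iff eq[of "\<lambda>_. True", symmetric] by simp_all
      then have A: "T \<le> A N" "A N \<le> T + G" by (simp_all add: T_def G_def card_words)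
      have "real (\<Sum>u\<in>U. card {v \<in> words D K. P (word_value g v + g ^ K * u)}) \<le> B N"
        "B N \<le> real ((\<Sum>u\<in>U. card {v \<in> words D K. P (word_value g v + g ^ K * u)}) + 2 * g ^ K)"
        using card_cantor_set_blocks[where N = N and K = K and P = P] unfolding B_def U_def of_nat_le_iff by simp_all
      then have B: "S \<le> B N" "B N \<le> S + G" by (simp_all add: S_def G_def)
      have "\<bar>S - \<mu> * T\<bar> = \<bar>\<Sum>u\<in>U. real (card {v \<in> words D K. P (word_value g v + g ^ K * u)})
          - \<mu> * real t ^ K\<bar>"
        by (simp add: S_def T_def sum_subtractf algebra_simps)
      also have "\<dots> \<le> (\<Sum>u\<in>U. e / 4 * real t ^ K)"
      proof (rule order_trans[OF sum_abs sum_mono])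
        fix u assume "u \<in> U"
        then have "u \<in> C" by (simp add: U_def)
        let ?q = "prob K (int b - int (g ^ K * u)) (int b' - int (digit_sum g u))"
        have "{v \<in> words D K. P (word_value g v + g ^ K * u)} =
            {v \<in> words D K. cls (int b - int (g ^ K * u)) (int b' - int (digit_sum g u)) v}"
          using cls_add_iff[OF _ \<open>u \<in> C\<close>] unfolding P_def by blast
        then have "real (card {v \<in> words D K. P (word_value g v + g ^ K * u)}) - \<mu> * real t ^ K =
            (?q - \<mu>) * real t ^ K"
          by (simp only: card_class left_diff_distrib)
        also have "\<bar>\<dots>\<bar> \<le> e / 4 * real t ^ K"
          using K[of "int b - int (g ^ K * u)" "int b' - int (digit_sum g u)"]
            \<open>0 < e\<close>
          unfolding abs_mult by (intro mult_mono) auto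
        finally show "\<bar>real (card {v \<in> words D K. P (word_value g v + g ^ K * u)}) - \<mu> * real t ^ K\<bar>
          \<le> e / 4 * real t ^ K" .
      qed
      also have "\<dots> = e / 4 * T" by (simp add: T_def)
      also have "\<dots> \<le> e / 4 * A N" using A(1) \<open>0 < e\<close> by (intro mult_left_mono) auto
      finally have "\<bar>S - \<mu> * T\<bar> \<le> e / 4 * A N" .
      moreover have "\<mu> * T \<le> \<mu> * A N" using A(1) \<mu>(1) by (rule mult_left_mono)
      moreover have "\<mu> * A N \<le> \<mu> * T + G"
      proof -
        have "\<mu> * A N \<le> \<mu> * (T + G)" using A(2) \<mu>(1) by (rule mult_left_mono)
        moreover have "\<mu> * G \<le> 1 * G" using \<mu>(2) by (rule mult_right_mono) (simp add: G_def)
        ultimately show ?thesis by (simp add: distrib_left)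
      qed
      moreover have "G < e / 4 * A N" using that \<open>0 < e\<close> by (simp add: field_simps)
      ultimately have "\<bar>B N - \<mu> * A N\<bar> < e * A N" using B by linarith
      moreover have "B N / A N - \<mu> = (B N - \<mu> * A N) / A N" using that by (simp add: field_simps)
      ultimately show ?thesis using that by (simp add: dist_real_def pos_divide_less_eq)
    qed
    moreover have "\<forall>\<^sub>F N in sequentially. A N > max 0 (4 * G / e)"
      using filterlim_card_cantor_set unfolding A_def filterlim_at_top_dense by blast
    ultimately show "\<forall>\<^sub>F N in sequentially. dist (B N / A N) \<mu> < e"
      by (auto elim: eventually_mono)
  qed
  then show "(\<lambda>N. real (card ({n \<in> C. [n = b] (mod a) \<and> [digit_sum g n = b'] (mod a')} \<inter> {0..<N})) /
      real (card (C \<inter> {0..<N}))) \<longlonglongrightarrow> 1 / (real a * real a')"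
    unfolding A_def B_def P_def \<mu>_def eq .
qed

section \<open>Words of one length in every class\<close>

lemma cls_cong:
  assumes "[b = c] (mod int a)" "[b' = c'] (mod int a')" "cls b b' w"
  shows "cls c c' w"
  using assms(3) cong_trans[OF _ assms(1)] cong_trans[OF _ assms(2)] by (simp add: in_class_def)

lemma cls_concat_replicate:
  assumes "p dvd length w" "cls b b' w"
  shows "cls (int n * b) (int n * b') (concat (replicate n w))"
proof (induction n)
  case (Suc n)
  then have "cls (b + int n * b) (b' + int n * b') (w @ concat (replicate n w))"
    by (rule cls_append[OF assms])
  then show ?case by (simp add: algebra_simps)
qed (simp add: in_class_def)

text \<open>The attainable residues \<open>X\<close> are closed under addition and congruence modulo
  \<open>a\<close>, hence under gcd, so \<open>Gcd X\<close> is attained. It divides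
  \<open>a\<close>, being attained as the residue 0, and all digit differences; by
  \<open>no_div\<close> it is 1.\<close>

lemma ex_word_value_cong_1:
  assumes no_div: "\<And>q. q dvd a \<Longrightarrow> (\<And>x y. x \<in> D \<Longrightarrow> y \<in> D \<Longrightarrow> [x = y] (mod q)) \<Longrightarrow> q = 1"
  obtains w where "set w \<subseteq> D" "p dvd length w" "[word_value g w = 1] (mod a)"
proof -
  define X where "X = {x. \<exists>w. set w \<subseteq> D \<and> p dvd length w \<and> [word_value g w = x] (mod a)}"
  have 0: "0 \<in> X" unfolding X_def by (intro CollectI exI[of _ "[]"]) simp
  have cong: "y \<in> X" if "x \<in> X" "[x = y] (mod a)" for x y
    using that(1) cong_trans[OF _ that(2)] unfolding X_def by blast
  have add: "x + y \<in> X" if "x \<in> X" "y \<in> X" for x y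
  proof -
    obtain v w where v: "set v \<subseteq> D" "p dvd length v" "[word_value g v = x] (mod a)"
      and w: "set w \<subseteq> D" "p dvd length w" "[word_value g w = y] (mod a)"
      using \<open>x \<in> X\<close> \<open>y \<in> X\<close> by (auto simp: X_def)
    have "[word_value g (v @ w) = x + y] (mod a)"
      by (rule cong_trans[OF word_value_append_cong[OF v(2)] cong_add[OF v(3) w(3)]])
    moreover have "set (v @ w) \<subseteq> D" "p dvd length (v @ w)" using v w by auto
    ultimately show ?thesis unfolding X_def by blast
  qed
  have mult: "x * n \<in> X" if "x \<in> X" for x n
    using that by (induction n) (auto intro: 0 add)
  have "Gcd X \<in> X"
  proof (rule Gcd_in)
    fix x y assume "x \<in> X" "y \<in> X"
    show "gcd x y \<in> X"
    proof (cases "x = 0")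
      case False
      then obtain m n where mn: "x * m = y * n + gcd x y" using bezout_nat by blast
      obtain h where "a = Suc h" using pos by (cases a) auto
      \<comment> \<open>Modulo \<open>a\<close> the factor \<open>a - 1\<close> acts as -1, which
        turns the Bezout identity into a combination with nonnegative coefficients.\<close>
      then have "x * m + y * (n * (a - 1)) = gcd x y + a * (y * n)"
        unfolding mn by (simp add: algebra_simps)
      moreover have "[gcd x y + a * (y * n) = gcd x y] (mod a)" by (simp add: cong_def)
      moreover have "x * m + y * (n * (a - 1)) \<in> X"
        using \<open>x \<in> X\<close> \<open>y \<in> X\<close> by (intro add mult)
      ultimately show ?thesis using cong by metis
    qed (use \<open>y \<in> X\<close> in simp)
  qed (use 0 in blast)
  moreover have "Gcd X = 1"
  proof (rule no_div)
    have "a \<in> X" by (rule cong[OF 0]) (simp add: cong_def)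
    then show "Gcd X dvd a" by (rule Gcd_dvd)
    have diff: "x - y \<in> X" if "x \<in> D" "y \<in> D" "y \<le> x" for x y
    proof -
      \<comment> \<open>Changing the lowest letter of a constant word, which has weight 1, shifts
        its value 0 modulo \<open>a\<close> by exactly \<open>x - y\<close>.\<close>
      define w where "w = x # replicate (p - 1) y"
      have "replicate p y = y # replicate (p - 1) y" using p_pos by (cases p) auto
      then have "word_value g w = word_value g (replicate p y) + (x - y)"
        using \<open>y \<le> x\<close> by (simp add: w_def)
      moreover have "[word_value g (replicate p y) + (x - y) = 0 + (x - y)] (mod a)"
        by (intro cong_add word_value_replicate) auto
      ultimately have "[word_value g w = x - y] (mod a)" by simp
      moreover have "set w \<subseteq> D" "p dvd length w" using that p_pos by (auto simp: w_def)
      ultimately show ?thesis unfolding X_def by blast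
    qed
    fix x y assume "x \<in> D" "y \<in> D"
    then show "[x = y] (mod Gcd X)"
    proof (induction x y rule: linorder_wlog)
      case (le x y)
      then have "Gcd X dvd y - x" by (intro Gcd_dvd diff)
      then show ?case using le by (simp add: cong_altdef_nat cong_sym_eq[of x])
    qed (simp add: cong_sym_eq)
  qed
  ultimately have "1 \<in> X" by simp
  then show ?thesis using that by (auto simp: X_def)
qed

text \<open>With \<open>u\<close> of class \<open>(1, s)\<close> and \<open>v\<close> of class
  \<open>(0, 1)\<close>, \<open>m\<close> copies of \<open>u\<close> and \<open>n\<close> copies of
  \<open>v\<close> have class \<open>(m, m * s + n)\<close>. Constant padding brings all these words
  to the same length.\<close>

lemma ex_words_all_classes:
  assumes no_div: "\<And>q. q dvd a \<Longrightarrow> (\<And>x y. x \<in> D \<Longrightarrow> y \<in> D \<Longrightarrow> [x = y] (mod q)) \<Longrightarrow> q = 1"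
    and v: "set v \<subseteq> D" "p dvd length v" "cls 0 1 v"
  obtains k where "p dvd k" "\<And>b b'. \<exists>w\<in>words D k. cls b b' w"
proof -
  obtain u where u: "set u \<subseteq> D" "p dvd length u" "[word_value g u = 1] (mod a)"
    using ex_word_value_cong_1[OF no_div] by blast
  define s where "s = int (sum_list u)"
  have "cls 1 s u" using u(3) cong_int_iff[of _ 1 a] by (simp add: in_class_def s_def)
  obtain e where e: "e \<in> D" using two_digits by fastforce
  have len: "length (concat (replicate n w)) = n * length w" for n and w :: "nat list"
    by (induction n) auto
  \<comment> \<open>Room for the largest repetition counts, since \<open>m\<close> and
    \<open>n\<close> stay below \<open>a\<close> and \<open>a'\<close>.\<close>
  define k where "k = a * length u + a' * length v"
  have "\<exists>w\<in>words D k. cls b b' w" for b b'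
  proof -
    define m where "m = nat (b mod int a)"
    \<comment> \<open>The copies of \<open>v\<close> correct the digit sum \<open>m * s\<close>
      brought in by the copies of \<open>u\<close>.\<close>
    define n where "n = nat ((b' - int m * s) mod int a')"
    have m: "int m = b mod int a" "m \<le> a"
      using pos by (auto simp: m_def nat_le_iff less_imp_le)
    have n: "int n = (b' - int m * s) mod int a'" "n \<le> a'"
      using pos by (auto simp: n_def nat_le_iff less_imp_le)
    define j where "j = (a - m) * length u + (a' - n) * length v"
    define w where "w = concat (replicate m u) @ concat (replicate n v) @ replicate j e"
    have "p dvd j" using u v by (simp add: j_def)
    have "m * length u \<le> a * length u" "n * length v \<le> a' * length v"
      using m n by simp_all
    then have "length w = k"
      unfolding w_def k_def j_def length_append len diff_mult_distrib length_replicate by linarith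
    moreover have "set w \<subseteq> D" using u v e by (auto simp: w_def)
    ultimately have "w \<in> words D k" by (simp add: words_def)
    have "cls (int m * 1 + (int n * 0 + 0)) (int m * s + (int n * 1 + 0)) w"
      unfolding w_def using u(2) v(2) \<open>cls 1 s u\<close> v(3) \<open>p dvd j\<close>
      by (intro cls_append cls_concat_replicate cls_replicate) (auto simp: len)
    moreover have "[int m * 1 + (int n * 0 + 0) = b] (mod int a)"
      by (simp add: m cong_def)
    moreover have "[int m * s + (int n * 1 + 0) = b'] (mod int a')"
      unfolding n(1) by (simp add: cong_def mod_add_right_eq)
    ultimately have "cls b b' w" using cls_cong by blast
    then show ?thesis using \<open>w \<in> words D k\<close> by blast
  qed
  moreover have "p dvd k" using u v by (simp add: k_def)
  ultimately show ?thesis using that by blast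
qed

section \<open>Characterization by common divisors and a single word\<close>

lemma jointly_unif_distributed_iff:
  "jointly_unif_distributed g C a a' \<longleftrightarrow>
    (\<forall>q. q dvd a \<longrightarrow> (\<forall>x\<in>D. \<forall>y\<in>D. [x = y] (mod q)) \<longrightarrow> q = 1) \<and>
    (\<exists>w. set w \<subseteq> D \<and> p dvd length w \<and> cls 0 1 w)" (is "_ \<longleftrightarrow> ?gcd \<and> ?word")
proof
  assume unif: "jointly_unif_distributed g C a a'"
  obtain k where k: "\<exists>w\<in>words D (p * k). cls (int 0) (int 1) w"
    "\<exists>w\<in>words D (p * k). cls (int 1) (int 1) w"
  proof -
    have "\<forall>\<^sub>F k in sequentially. (\<exists>w\<in>words D k. cls (int 0) (int 1) w) \<and>
        (\<exists>w\<in>words D k. cls (int 1) (int 1) w)"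
      by (intro eventually_conj eventually_in_class unif pos)
    then obtain k where "\<And>j. j \<ge> k \<Longrightarrow> (\<exists>w\<in>words D j. cls (int 0) (int 1) w) \<and>
        (\<exists>w\<in>words D j. cls (int 1) (int 1) w)"
      by (auto simp: eventually_sequentially)
    \<comment> \<open>The common length must be a multiple of \<open>p\<close> and also lie beyond
      the threshold.\<close>
    moreover have "p * k \<ge> k" using p_pos by simp
    ultimately show ?thesis using that by blast
  qed
  then obtain v w where v: "v \<in> words D (p * k)" "cls (int 0) (int 1) v"
    and w: "w \<in> words D (p * k)" "cls (int 1) (int 1) w" by blast
  have ?gcd
  proof (intro allI impI)
    fix q assume q: "q dvd a" "\<forall>x\<in>D. \<forall>y\<in>D. [x = y] (mod q)"
    have "[word_value g v = 0] (mod a)" "[word_value g w = 1] (mod a)"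
      using v(2) w(2) unfolding in_class_def cong_int_iff by auto
    then have "[word_value g v = 0] (mod q)" "[word_value g w = 1] (mod q)"
      using q(1) cong_dvd_modulus_nat by blast+
    \<comment> \<open>The two words have equal length, so their values 0 and 1 modulo
      \<open>a\<close> must agree modulo \<open>q\<close>.\<close>
    moreover have "[word_value g v = word_value g w] (mod q)"
      using v(1) w(1) q(2) by (intro words_value_cong) auto
    ultimately have "[1 = 0] (mod q)" using cong_trans cong_sym by blast
    then show "q = 1" by (simp add: cong_0_iff)
  qed
  moreover have ?word using v by (auto simp: words_def)
  ultimately show "?gcd \<and> ?word" ..
next
  assume "?gcd \<and> ?word"
  then obtain v where "set v \<subseteq> D" "p dvd length v" "cls 0 1 v" by blast
  moreover have "q = 1" if "q dvd a" "\<And>x y. x \<in> D \<Longrightarrow> y \<in> D \<Longrightarrow> [x = y] (mod q)" for q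
    using \<open>?gcd \<and> ?word\<close> that by blast
  ultimately obtain k where "p dvd k" "\<And>b b'. \<exists>w\<in>words D k. cls b b' w"
    using ex_words_all_classes by blast
  then show "jointly_unif_distributed g C a a'" by (rule jointly_unif_distributedI)
qed

end

section \<open>Translation to the gcd of the digit differences\<close>

theorem proposition5p6:
  fixes g t a a' p :: nat and d :: "nat \<Rightarrow> nat" and D :: "nat set"
  assumes "g \<ge> 2"
    and "t \<ge> 2"
    and "inj_on d {1..t}"
    and "D = d ` {1..t}"
    and "D \<subseteq> {0..g - 1}"
    and "\<And>i. i \<in> {1..t} \<Longrightarrow> d 1 \<le> d i"
    and "a \<ge> 1"
    and "a' \<ge> 1"
    and "gcd g a = 1"
    and "p = a' * totient (a * (g - 1))"
  shows "jointly_unif_distributed g (cantor_set g D) a a' \<longleftrightarrow>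
    Gcd (insert a ((\<lambda>i. d i - d 1) ` {2..t})) = 1 \<and>
    (\<exists>w. set w \<subseteq> D \<and> [word_value g w = 0] (mod a) \<and>
         [word_digit_sum w = 1] (mod a') \<and> [length w = 0] (mod p))"
proof -
  have D: "d 1 \<in> D" "card D = t" "D \<subseteq> {..<g}"
    using assms(1-5) by (auto simp: card_image)
  have walk: "digit_walk g D a a' p"
    using assms(1,2,7,8,10) assms(9)[folded coprime_iff_gcd_eq_1] D(2,3)
    by unfold_locales simp_all
  \<comment> \<open>Differences to the smallest digit detect the same divisors of \<open>a\<close>
    as all pairs of digits do.\<close>
  have "Gcd (insert a ((\<lambda>i. d i - d 1) ` {2..t})) = 1 \<longleftrightarrow>
      (\<forall>q. q dvd a \<longrightarrow> (\<forall>x\<in>D. \<forall>y\<in>D. [x = y] (mod q)) \<longrightarrow> q = 1)" (is "?G = 1 \<longleftrightarrow> ?no_div")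
  proof
    assume "?G = 1"
    show ?no_div
    proof (intro allI impI)
      fix q assume q: "q dvd a" "\<forall>x\<in>D. \<forall>y\<in>D. [x = y] (mod q)"
      have "q dvd d i - d 1" if "i \<in> {2..t}" for i
      proof -
        have "i \<in> {1..t}" using that by simp
        \<comment> \<open>Minimality of \<open>d 1\<close> makes the natural-number difference
          \<open>d i - d 1\<close> a true difference.\<close>
        then have "[d i = d 1] (mod q)" "d 1 \<le> d i" using q(2) D(1) assms(4,6) by auto
        then show ?thesis by (simp add: cong_altdef_nat)
      qed
      then have "q dvd ?G" using q(1) by (intro Gcd_greatest) auto
      then show "q = 1" unfolding \<open>?G = 1\<close> by simp
    qed
  next
    assume ?no_div
    have "[x = d 1] (mod ?G)" if "x \<in> D" for x
    proof -
      obtain i where i: "i \<in> {1..t}" "x = d i" using \<open>x \<in> D\<close> assms(4) by auto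
      show ?thesis
      proof (cases "i = 1")
        case False
        then have "?G dvd d i - d 1" using i(1) by (intro Gcd_dvd) auto
        then show ?thesis using assms(6)[OF i(1)] i(2) by (simp add: cong_altdef_nat)
      qed (simp add: i)
    qed
    then have "\<forall>x\<in>D. \<forall>y\<in>D. [x = y] (mod ?G)" by (meson cong_trans cong_sym)
    moreover have "?G dvd a" by (rule Gcd_dvd) simp
    ultimately show "?G = 1" using \<open>?no_div\<close> by blast
  qed
  moreover have "in_class g a a' 0 1 w \<longleftrightarrow>
      [word_value g w = 0] (mod a) \<and> [word_digit_sum w = 1] (mod a')" for w
    using in_class_int_iff[of g a a' 0 1 w] by (simp add: word_digit_sum_def cong_def)
  ultimately show ?thesis
    unfolding digit_walk.jointly_unif_distributed_iff[OF walk] cong_0_iff by blast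
qed

end
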